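(* Let $P(x)=x^3+k_2x+k_3$ be a real polynomial with $P(x)\neq x^3$. Then $P(x)$ is $\mathcal{R}$ if and only if $P(x)$ is $\mathcal{IR}$.
   Context: A monic real polynomial $P(x)$ of degree $n$ is realizable ($\mathcal{R}$) if it is the characteristic polynomial of some $n\times n$ entrywise nonnegative matrix; it is irreducibly realizable ($\mathcal{IR}$) if it is the characteristic polynomial of some $n\times n$ irreducible entrywise nonnegative matrix. A square matrix is irreducible if it is not similar by a permutation matrix to a nontrivially block triangular matrix (equivalently, its digraph is strongly connected). *)

theory Defs
  imports "Jordan_Normal_Form.Char_Poly"
begin

definition nonneg_mat :: "real mat \<Rightarrow> bool" where
  "nonneg_mat A \<longleftrightarrow> (\<forall>i < dim_row A. \<forall>j < dim_col A. 0 \<le> A $$ (i, j))"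

definition permutation_mat :: "real mat \<Rightarrow> bool" where
  "permutation_mat P \<longleftrightarrow>
     (\<exists>n p. p permutes {0..<n} \<and> P = mat n n (\<lambda>(i, j). if j = p i then 1 else 0))"

text \<open>
  Two square diagonal blocks of positive size suffice: several diagonal blocks can be grouped
  into two. Upper triangular form is no restriction when the matrix is considered up to
  similarity by permutation matrices, since reversing the order of the indices
  exchanges upper and lower block triangular form.
\<close>

definition block_triangular_mat :: "real mat \<Rightarrow> bool" where
  "block_triangular_mat B \<longleftrightarrow>
     (\<exists>k m B1 B2 B4. 0 < k \<and> 0 < m \<and>
        B1 \<in> carrier_mat k k \<and> B2 \<in> carrier_mat k m \<and> B4 \<in> carrier_mat m m \<and>
        B = four_block_mat B1 B2 (0\<^sub>m m k) B4)"

text \<open>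
  The predicate \<open>similar_mat_wit A B P Q\<close> says that \<open>A = P * B * Q\<close> with \<open>P\<close> and \<open>Q\<close> mutually
  inverse. Every \<open>1 \<times> 1\<close> matrix is irreducible, including the zero matrix.
\<close>

definition irreducible_mat :: "real mat \<Rightarrow> bool" where
  "irreducible_mat A \<longleftrightarrow> square_mat A \<and>
     \<not> (\<exists>B P Q. permutation_mat P \<and> similar_mat_wit A B P Q \<and> block_triangular_mat B)"

text \<open>Monicity need not be demanded below: every characteristic polynomial is monic.\<close>

definition realizable :: "real poly \<Rightarrow> bool" where
  "realizable P \<longleftrightarrow>
     (\<exists>A \<in> carrier_mat (degree P) (degree P). nonneg_mat A \<and> char_poly A = P)"

definition irreducibly_realizable :: "real poly \<Rightarrow> bool" where
  "irreducibly_realizable P \<longleftrightarrow>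
     (\<exists>A \<in> carrier_mat (degree P) (degree P).
        nonneg_mat A \<and> irreducible_mat A \<and> char_poly A = P)"

end

theory Submission
  imports Defs
begin

text \<open>
  A nonnegative matrix realizing \<open>P\<close> has trace \<open>0\<close>, hence zero diagonal, and expanding its
  characteristic polynomial gives \<open>k\<^sub>2 \<le> 0\<close> and \<open>k\<^sub>3 \<le> 0\<close>. Conversely, under these two
  inequalities the matrix with rows \<open>(0, 1, 0)\<close>, \<open>(- k\<^sub>2 / 2, 0, 1)\<close>, \<open>(- k\<^sub>3, - k\<^sub>2 / 2, 0)\<close>
  is nonnegative and has characteristic polynomial \<open>P\<close>. Its digraph contains the path
  \<open>0 \<rightarrow> 1 \<rightarrow> 2\<close>, which is closed up by the edge \<open>2 \<rightarrow> 0\<close> if \<open>k\<^sub>3 \<noteq> 0\<close> and by the edges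
  \<open>2 \<rightarrow> 1 \<rightarrow> 0\<close> if \<open>k\<^sub>2 \<noteq> 0\<close>.
\<close>

lemma det_2:
  fixes A :: "'a :: comm_ring_1 mat"
  assumes A: "A \<in> carrier_mat 2 2"
  shows "det A = A $$ (0,0) * A $$ (1,1) - A $$ (0,1) * A $$ (1,0)"
proof -
  have "det A = (\<Sum>j<2. A $$ (0,j) * cofactor A 0 j)"
    by (rule laplace_expansion_row[OF A]) simp
  then show ?thesis
    using A by (simp add: numeral_2_eq_2 cofactor_def det_single mat_delete_def)
qed

lemma det_3:
  fixes A :: "'a :: comm_ring_1 mat"
  assumes A: "A \<in> carrier_mat 3 3"
  shows "det A =
      A $$ (0,0) * (A $$ (1,1) * A $$ (2,2) - A $$ (1,2) * A $$ (2,1))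
    - A $$ (0,1) * (A $$ (1,0) * A $$ (2,2) - A $$ (1,2) * A $$ (2,0))
    + A $$ (0,2) * (A $$ (1,0) * A $$ (2,1) - A $$ (1,1) * A $$ (2,0))"
proof -
  have minor: "det (mat_delete A 0 j) =
      mat_delete A 0 j $$ (0,0) * mat_delete A 0 j $$ (1,1) -
      mat_delete A 0 j $$ (0,1) * mat_delete A 0 j $$ (1,0)" for j
    by (rule det_2) (use mat_delete_carrier[of A 3 3] A in simp)
  have "det A = (\<Sum>j<3. A $$ (0,j) * cofactor A 0 j)"
    by (rule laplace_expansion_row[OF A]) simp
  then show ?thesis
    using A by (simp add: numeral_3_eq_3 cofactor_def minor)
      (simp add: mat_delete_def numeral_2_eq_2 algebra_simps)
qed

text \<open>Up to sign, the coefficients are the sums of the principal minors of sizes 3, 2 and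
  1.\<close>

lemma char_poly_3:
  fixes A :: "'a :: comm_ring_1 mat"
  assumes A: "A \<in> carrier_mat 3 3"
  shows "char_poly A =
    [:- (A $$ (0,0) * (A $$ (1,1) * A $$ (2,2) - A $$ (1,2) * A $$ (2,1))
        - A $$ (0,1) * (A $$ (1,0) * A $$ (2,2) - A $$ (1,2) * A $$ (2,0))
        + A $$ (0,2) * (A $$ (1,0) * A $$ (2,1) - A $$ (1,1) * A $$ (2,0))),
      A $$ (0,0) * A $$ (1,1) - A $$ (0,1) * A $$ (1,0)
        + A $$ (0,0) * A $$ (2,2) - A $$ (0,2) * A $$ (2,0)
        + A $$ (1,1) * A $$ (2,2) - A $$ (1,2) * A $$ (2,1),
      - (A $$ (0,0) + A $$ (1,1) + A $$ (2,2)), 1:]"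
proof -
  have "char_poly_matrix A \<in> carrier_mat 3 3"
    using A by simp
  then show ?thesis
    unfolding char_poly_def using A
    by (simp add: det_3 char_poly_matrix_def algebra_simps)
qed

text \<open>Strong connectivity is phrased by cuts rather than paths: a block triangular form would
  give a proper nonempty set of indices that no edge enters. The zero block at the lower left fixes
  the direction of \<open>edge\<close>.\<close>

lemma irreducible_matI:
  assumes A: "A \<in> carrier_mat n n"
    and edge: "\<And>S. S \<subset> {0..<n} \<Longrightarrow> S \<noteq> {} \<Longrightarrow>
      \<exists>i \<in> {0..<n} - S. \<exists>j \<in> S. A $$ (i,j) \<noteq> 0"
  shows "irreducible_mat A"
  unfolding irreducible_mat_def
proof (intro conjI notI)
  show "square_mat A"
    using A by simp
next
  assume "\<exists>B P Q. permutation_mat P \<and> similar_mat_wit A B P Q \<and> block_triangular_mat B"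
  then obtain B P Q where P: "permutation_mat P" and wit: "similar_mat_wit A B P Q"
    and "block_triangular_mat B" by blast
  then obtain k m B1 B2 B4 where k: "0 < k" and m: "0 < m"
    and carr: "B1 \<in> carrier_mat k k" "B2 \<in> carrier_mat k m" "B4 \<in> carrier_mat m m"
    and B: "B = four_block_mat B1 B2 (0\<^sub>m m k) B4"
    unfolding block_triangular_mat_def by blast
  note sim = similar_mat_witD2[OF A wit]
  have n: "n = k + m"
    using sim(5) B carr by auto
  obtain p where p: "p permutes {0..<n}"
    and P_eq: "P = mat n n (\<lambda>(i, j). if j = p i then 1 else 0)"
    using P sim(6) unfolding permutation_mat_def by auto
  have p_less: "p i < n" if "i < n" for i
    using permutes_in_image[OF p, of i] that by simp
  have "A * P = P * B * (Q * P)"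
    unfolding sim(3)
    by (rule assoc_mult_mat[OF mult_carrier_mat[OF sim(6,5)] sim(7,6)])
  then have AP: "A * P = P * B"
    by (simp add: sim(2) right_mult_one_mat[OF mult_carrier_mat[OF sim(6,5)]])
  have A_entry: "A $$ (i,j) = B $$ (p i, p j)" if ij: "i < n" "j < n" for i j
  proof -
    \<comment> \<open>Column \<open>p j\<close> of \<open>P\<close> has its only 1 in row
      \<open>j\<close>, as \<open>p\<close> is injective, and row \<open>i\<close> has its only 1 in
      column \<open>p i\<close>. So both products collapse to one term at
      \<open>(i, p j)\<close>.\<close>
    have "(A * P) $$ (i, p j) = (\<Sum>l\<in>{0..<n}. A $$ (i,l) * P $$ (l, p j))"
      using ij(1) p_less[OF ij(2)] A sim(6) by (simp add: scalar_prod_def)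
    also have "\<dots> = (\<Sum>l\<in>{0..<n}. if l = j then A $$ (i,l) else 0)"
      using p_less[OF ij(2)] by (intro sum.cong) (auto simp: P_eq inj_eq[OF permutes_inj[OF p]])
    also have "\<dots> = A $$ (i,j)"
      using ij(2) by simp
    finally have "(A * P) $$ (i, p j) = A $$ (i,j)" .
    moreover have "(P * B) $$ (i, p j) = (\<Sum>l\<in>{0..<n}. P $$ (i,l) * B $$ (l, p j))"
      using ij(1) p_less[OF ij(2)] sim(5,6) by (simp add: scalar_prod_def)
    moreover have "\<dots> = (\<Sum>l\<in>{0..<n}. if l = p i then B $$ (l, p j) else 0)"
      using ij(1) by (intro sum.cong) (simp_all add: P_eq)
    moreover have "\<dots> = B $$ (p i, p j)"
      using p_less[OF ij(1)] by simp
    ultimately show ?thesis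
      using AP by simp
  qed
  define S where "S = {i \<in> {0..<n}. p i < k}"
  \<comment> \<open>Since \<open>p\<close> is onto, both diagonal blocks are hit: \<open>0\<close>
    lies in the first and \<open>k\<close> in the second.\<close>
  have "0 \<in> p ` {0..<n}" "k \<in> p ` {0..<n}"
    unfolding permutes_image[OF p] using n k m by simp_all
  then obtain i0 i1 where i01: "i0 < n" "p i0 = 0" "i1 < n" "p i1 = k"
    by (elim imageE) simp
  have "i0 \<in> S" "i1 \<in> {0..<n} - S" "S \<subseteq> {0..<n}"
    using i01 k by (simp_all add: S_def subset_iff)
  then have "S \<subset> {0..<n}" "S \<noteq> {}"
    by blast+
  then obtain i j where ij: "i < n" "\<not> p i < k" "j < n" "p j < k" "A $$ (i,j) \<noteq> 0"
    using edge[of S] unfolding S_def by fastforce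
  then have "B $$ (p i, p j) = 0"
    using p_less[of i] n carr by (auto simp: B)
  with ij A_entry show False by simp
qed

theorem theorem24:
  fixes k\<^sub>2 k\<^sub>3 :: real and P :: "real poly"
  assumes "P = monom 1 3 + monom k\<^sub>2 1 + [:k\<^sub>3:]"
    and "P \<noteq> monom 1 3"
  shows "realizable P \<longleftrightarrow> irreducibly_realizable P"
proof
  assume "irreducibly_realizable P"
  then show "realizable P"
    unfolding irreducibly_realizable_def realizable_def by blast
next
  assume "realizable P"
  have P: "P = [:k\<^sub>3, k\<^sub>2, 0, 1:]"
    by (simp add: assms(1) monom_altdef numeral_3_eq_3)
  have deg: "degree P = 3"
    by (simp add: P)
  have nz: "k\<^sub>2 \<noteq> 0 \<or> k\<^sub>3 \<noteq> 0"
    using assms by auto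
  obtain A where A: "A \<in> carrier_mat 3 3" and nonneg: "nonneg_mat A" and cp: "char_poly A = P"
    using \<open>realizable P\<close> deg unfolding realizable_def by auto
  have ge: "0 \<le> A $$ (i,j)" if "i < 3" "j < 3" for i j
    using nonneg A that by (auto simp: nonneg_mat_def)
  note coeffs = char_poly_3[OF A, unfolded cp P, simplified pCons_eq_iff]
  have "A $$ (0,0) = 0" "A $$ (1,1) = 0" "A $$ (2,2) = 0"
    using coeffs ge[of 0 0] ge[of 1 1] ge[of 2 2] by auto
  \<comment> \<open>With zero diagonal only cycles of length 2 contribute to
    \<open>k\<^sub>2\<close>, and only the two 3-cycles to \<open>k\<^sub>3\<close>.\<close>
  then have k2: "k\<^sub>2 = - (A $$ (0,1) * A $$ (1,0) + A $$ (0,2) * A $$ (2,0) + A $$ (1,2) * A $$ (2,1))"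
    and k3: "k\<^sub>3 = - (A $$ (0,1) * (A $$ (1,2) * A $$ (2,0)) + A $$ (0,2) * (A $$ (1,0) * A $$ (2,1)))"
    using coeffs by auto
  have le: "k\<^sub>2 \<le> 0" "k\<^sub>3 \<le> 0"
    unfolding k2 k3 neg_le_0_iff_le by (intro add_nonneg_nonneg mult_nonneg_nonneg ge; simp)+
  \<comment> \<open>Halving \<open>k\<^sub>2\<close> shares its weight between the 2-cycles through
    0, 1 and through 1, 2, so both return edges are present when
    \<open>k\<^sub>2 \<noteq> 0\<close>. The zero at \<open>(0,2)\<close> leaves a single 3-cycle,
    of weight \<open>- k\<^sub>3\<close>.\<close>
  define M where "M = mat_of_rows_list 3 [[0, 1, 0], [- k\<^sub>2 / 2, 0, 1], [- k\<^sub>3, - k\<^sub>2 / 2, 0]]"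
  have M: "M \<in> carrier_mat 3 3"
    by (simp add: M_def mat_of_rows_list_def numeral_3_eq_3)
  have entries: "M $$ (0,0) = 0" "M $$ (0,1) = 1" "M $$ (0,2) = 0"
    "M $$ (1,0) = - k\<^sub>2 / 2" "M $$ (1,1) = 0" "M $$ (1,2) = 1"
    "M $$ (2,0) = - k\<^sub>3" "M $$ (2,1) = - k\<^sub>2 / 2" "M $$ (2,2) = 0"
    by (simp_all add: M_def mat_of_rows_list_def)
  have three: "{0..<3} = {0, 1, 2 :: nat}"
    by auto
  have "nonneg_mat M"
    unfolding nonneg_mat_def
  proof (intro allI impI)
    fix i j assume "i < dim_row M" "j < dim_col M"
    then have "i \<in> {0, 1, 2}" "j \<in> {0, 1, 2}"
      using M by auto
    then show "0 \<le> M $$ (i,j)"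
      using le entries by (elim insertE emptyE) simp_all
  qed
  moreover have "char_poly M = P"
    by (simp add: char_poly_3[OF M] entries[simplified] P)
  moreover have "irreducible_mat M"
  proof (rule irreducible_matI[OF M])
    fix S :: "nat set" assume S: "S \<subset> {0..<3}" "S \<noteq> {}"
    then have "S \<in> Pow {0, 1, 2} - {{}, {0, 1, 2}}"
      unfolding three psubset_eq by simp
    then have "S \<in> {{0}, {1}, {2}, {0, 1}, {0, 2}, {1, 2}}"
      unfolding Pow_insert Pow_empty by auto
    \<comment> \<open>Only the cuts \<open>{0}\<close> and \<open>{0, 1}\<close> need
      \<open>nz\<close>; each of the others is entered by one of the edges of weight 1.\<close>
    then show "\<exists>i \<in> {0..<3} - S. \<exists>j \<in> S. M $$ (i,j) \<noteq> 0"
      unfolding three using nz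
      by (elim insertE emptyE) (auto simp: insert_Diff_if entries[simplified])
  qed
  ultimately show "irreducibly_realizable P"
    unfolding irreducibly_realizable_def deg using M by blast
qed

end
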